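(* For all positive integers $k$, the graph $QI(k^2,k)$ is $(k!)^{k-1}$-regular.
   Context: For positive integers $n$ and $k$ with $n\ge k^2$, the qualitative independence graph $QI(n,k)$ is the graph whose vertex set is the set of all partitions of an $n$-set into $k$ non-empty classes with the property that every class has size at least $k$ (so for $n=k^2$ every class has size exactly $k$). Vertices are adjacent if and only if the corresponding partitions are qualitatively independent, where partitions $P=\{P_1,\dots,P_k\}$ and $Q=\{Q_1,\dots,Q_k\}$ are qualitatively independent if $P_i\cap Q_j\neq\emptyset$ for all $i,j\in\{1,\dots,k\}$. A graph is $d$-regular if every vertex has degree $d$. *)

theory Defs
  imports "HOL-Library.Disjoint_Sets" "Graph_Theory.Pair_Digraph"
begin

definition qualitatively_independent :: "'a set set \<Rightarrow> 'a set set \<Rightarrow> bool" where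
  "qualitatively_independent P Q \<longleftrightarrow> (\<forall>X\<in>P. \<forall>Y\<in>Q. X \<inter> Y \<noteq> {})"

definition QI_verts :: "'a set \<Rightarrow> nat \<Rightarrow> 'a set set set" where
  "QI_verts A k = {P. partition_on A P \<and> card P = k \<and> (\<forall>X\<in>P. k \<le> card X)}"

(* QI(n,k) on an arbitrary ground set A, to be used with finite A, card A = n and n >= k^2.
   An undirected edge is a symmetric pair of arcs.  Adjacency is exactly qualitative
   independence: for k >= 2 this relation is irreflexive (see QI_simple_graph), while for
   k = 1 the only vertex {A} is qualitatively independent of itself and so carries a loop,
   which is a single arc and contributes 1 to its degree. *)
definition QI :: "'a set \<Rightarrow> nat \<Rightarrow> 'a set set pair_pre_digraph" where
  "QI A k = \<lparr> pverts = QI_verts A k,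
     parcs = {(P, Q). P \<in> QI_verts A k \<and> Q \<in> QI_verts A k \<and> qualitatively_independent P Q} \<rparr>"

(* In a symmetric digraph the out-degree of a vertex is its number of neighbours. *)
definition regular_graph :: "nat \<Rightarrow> ('v, 'e) pre_digraph \<Rightarrow> bool" where
  "regular_graph d G \<longleftrightarrow> (\<forall>v\<in>verts G. out_degree G v = d)"

lemma qualitatively_independent_sym:
  "qualitatively_independent P Q \<Longrightarrow> qualitatively_independent Q P"
  unfolding qualitatively_independent_def by blast

lemma finite_QI_verts:
  assumes "finite A"
  shows "finite (QI_verts A k)"
proof (rule finite_subset)
  show "QI_verts A k \<subseteq> Pow (Pow A)"
    by (auto simp: QI_verts_def partition_on_def)
  show "finite (Pow (Pow A))" using assms by simp
qed

lemma QI_pseudo_graph: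
  assumes "finite A"
  shows "pair_pseudo_graph (QI A k)"
proof
  show "finite (pverts (QI A k))"
    using finite_QI_verts[OF assms] by (simp add: QI_def)
  have "parcs (QI A k) \<subseteq> QI_verts A k \<times> QI_verts A k"
    by (auto simp: QI_def)
  then show "finite (parcs (QI A k))"
    using finite_QI_verts[OF assms] by (meson finite_SigmaI finite_subset)
  show "symmetric (with_proj (QI A k))"
    by (auto simp: symmetric_def sym_def QI_def intro: qualitatively_independent_sym)
qed (auto simp: QI_def)

lemma QI_simple_graph:
  assumes "finite A" and "k \<ge> 2"
  shows "pair_graph (QI A k)"
proof -
  interpret pair_pseudo_graph "QI A k" using QI_pseudo_graph[OF assms(1)] .
  show ?thesis
  proof
    fix e assume "e \<in> parcs (QI A k)"
    then obtain P Q where e: "e = (P, Q)" and P: "partition_on A P" "card P = k"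
      and ind: "qualitatively_independent P Q"
      by (auto simp: QI_def QI_verts_def)
    obtain X Y where "X \<in> P" "Y \<in> P" "X \<noteq> Y"
      using P(2) assms(2) by (metis card_2_iff' obtain_subset_with_card_n subsetD)
    then have "\<not> qualitatively_independent P P"
      using P(1) by (auto simp: partition_on_def disjoint_def qualitatively_independent_def)
    with e ind show "fst e \<noteq> snd e" by auto
  qed
qed

end

theory Submission
  imports Defs
begin

text \<open>
  Since \<open>k\<close> classes of size at least \<open>k\<close> have to fit into a set with \<open>k\<^sup>2\<close> elements, every class of
  every vertex has exactly \<open>k\<close> elements. By the same count, if \<open>P\<close> and \<open>Q\<close> are adjacent, then the
  \<open>k\<close> classes of \<open>Q\<close> cut each class of \<open>P\<close>, which has \<open>k\<close> elements, into \<open>k\<close> nonempty pieces, so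
  each class of \<open>Q\<close> meets each class of \<open>P\<close> in a single point. The neighbours of \<open>P\<close> are therefore
  the partitions of the ground set into \<open>k\<close> transversals of \<open>P\<close>.

  Fix one class \<open>X0\<close> of \<open>P\<close>. Each transversal contains exactly one point of \<open>X0\<close>, and sending this
  point to the point where the transversal meets another class \<open>X\<close> is a bijection \<open>X0 \<rightarrow> X\<close>.
  Conversely, any choice of bijections \<open>X0 \<rightarrow> X\<close>, one for each of the remaining \<open>k - 1\<close> classes,
  glues to such a partition (\<open>bij_betw_neighbours\<close>). There are \<open>fact k\<close> choices for each bijection,
  which gives \<open>fact k ^ (k - 1)\<close> neighbours.
\<close>

section \<open>Tight counting\<close>

lemma summand_eq_lower_bound:
  fixes f :: "'i \<Rightarrow> nat"
  assumes "finite I" and "\<And>i. i \<in> I \<Longrightarrow> c \<le> f i" and "sum f I = c * card I" and "i \<in> I"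
  shows "f i = c"
  using sum_mono_inv[of "\<lambda>_. c" I f i] assms by (simp add: mult.commute)

lemma card_class_eq:
  assumes "finite A" and "card A = k\<^sup>2" and "P \<in> QI_verts A k" and "X \<in> P"
  shows "card X = k"
proof (rule summand_eq_lower_bound[of P k card X])
  have part: "partition_on A P" and card: "card P = k"
    using assms(3) by (auto simp: QI_verts_def)
  have "finite X" if "X \<in> P" for X
    using that part assms(1) by (metis Union_upper finite_subset partition_onD1)
  then have "card A = sum card P"
    using card_Union_disjoint[of P] part
    by (auto simp: partition_on_def disjnt_def pairwise_def)
  then show "sum card P = k * card P"
    using assms(2) card by (simp add: power2_eq_square)
  show "finite P"
    using finite_elements[OF assms(1) part] .
qed (use assms in \<open>auto simp: QI_verts_def\<close>)

text \<open>
  The \<open>card Q\<close> pieces that \<open>Q\<close> cuts out of \<open>X\<close> are disjoint and nonempty, and there are as many of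
  them as points of \<open>X\<close>.
\<close>

lemma card_inter_class_eq_1:
  assumes "finite A" and "partition_on A Q" and "X \<subseteq> A" and "card X = card Q"
    and "\<And>Y. Y \<in> Q \<Longrightarrow> X \<inter> Y \<noteq> {}" and "Y \<in> Q"
  shows "card (X \<inter> Y) = 1"
proof -
  have finX: "finite X"
    using assms(1,3) finite_subset by blast
  have finQ: "finite Q"
    using finite_elements[OF assms(1,2)] .
  have "X = (\<Union>Y\<in>Q. X \<inter> Y)"
    using assms(2,3) by (auto simp: partition_on_def)
  also have "card \<dots> = (\<Sum>Y\<in>Q. card (X \<inter> Y))"
    using finQ finX assms(2) by (intro card_UN_disjoint) (auto simp: partition_on_def disjoint_def)
  finally show ?thesis
    using assms finX finQ
    by (intro summand_eq_lower_bound[of Q 1 "\<lambda>Y. card (X \<inter> Y)"]) (auto simp: Suc_le_eq card_gt_0_iff)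
qed

section \<open>Bijections between finite sets\<close>

definition bijections :: "'a set \<Rightarrow> 'b set \<Rightarrow> ('a \<Rightarrow> 'b) set" where
  "bijections S T = {f \<in> S \<rightarrow>\<^sub>E T. bij_betw f S T}"

lemma card_bijections:
  assumes "finite S" and "finite T" and "card S = card T"
  shows "card (bijections S T) = fact (card T)"
proof -
  have "f ` S = T" if "f \<in> S \<rightarrow>\<^sub>E T" "inj_on f S" for f
    using that assms by (intro card_subset_eq) (auto simp: card_image)
  then have "bijections S T = {f \<in> S \<rightarrow>\<^sub>E T. inj_on f S}"
    by (auto simp: bijections_def bij_betw_def)
  then show ?thesis
    using card_inj_on_subset_funcset[OF assms(1,2) order_refl] assms(3)
    by (simp add: fact_prod_rev)
qed

section \<open>Gluing bijections to transversals\<close>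

text \<open>
  The bijection belonging to the class \<open>X0\<close> itself is forced to be the identity. Including it lets
  all classes be treated alike.
\<close>

definition gluing_data :: "'a set set \<Rightarrow> 'a set \<Rightarrow> ('a set \<Rightarrow> 'a \<Rightarrow> 'a) set" where
  "gluing_data P X0 = (\<Pi>\<^sub>E X\<in>P. if X = X0 then {\<lambda>x\<in>X0. x} else bijections X0 X)"

definition glue :: "'a set set \<Rightarrow> ('a set \<Rightarrow> 'a \<Rightarrow> 'a) \<Rightarrow> 'a \<Rightarrow> 'a set" where
  "glue P F x = (\<lambda>X. F X x) ` P"

lemma card_gluing_data:
  assumes "finite P" and "X0 \<in> P" and "\<And>X. X \<in> P \<Longrightarrow> finite X \<and> card X = k"
  shows "card (gluing_data P X0) = fact k ^ (card P - 1)"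
proof -
  have "card (gluing_data P X0)
      = (\<Prod>X\<in>P. card (if X = X0 then {\<lambda>x\<in>X0. x} else bijections X0 X))"
    unfolding gluing_data_def by (rule card_PiE[OF assms(1)])
  also have "\<dots> = (\<Prod>X\<in>P - {X0}. card (bijections X0 X))"
    by (subst prod.remove[OF assms(1,2)]) (auto intro: prod.cong)
  also have "\<dots> = (\<Prod>X\<in>P - {X0}. fact k)"
    using assms(2,3) by (intro prod.cong) (auto simp: card_bijections)
  also have "\<dots> = fact k ^ (card P - 1)"
    using assms(1,2) by (simp add: card_Diff_singleton)
  finally show ?thesis .
qed

context
  fixes A :: "'a set" and P :: "'a set set" and X0 :: "'a set"
  assumes part: "partition_on A P" and X0: "X0 \<in> P"
begin

lemma class_unique: "X \<in> P \<Longrightarrow> Y \<in> P \<Longrightarrow> a \<in> X \<Longrightarrow> a \<in> Y \<Longrightarrow> X = Y"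
  using part by (auto simp: partition_on_def disjoint_def)

lemma gluing_data_bij:
  assumes "F \<in> gluing_data P X0" and "X \<in> P"
  shows "bij_betw (F X) X0 X"
proof -
  have "F X \<in> (if X = X0 then {\<lambda>x\<in>X0. x} else bijections X0 X)"
    using assms unfolding gluing_data_def by (rule PiE_mem)
  then show ?thesis
    by (auto simp: bijections_def bij_betw_def inj_on_def split: if_splits)
qed

lemma gluing_data_extensional:
  assumes "F \<in> gluing_data P X0" and "X \<in> P"
  shows "F X \<in> extensional X0"
proof -
  have "F X \<in> (if X = X0 then {\<lambda>x\<in>X0. x} else bijections X0 X)"
    using assms unfolding gluing_data_def by (rule PiE_mem)
  then show ?thesis
    by (auto simp: bijections_def PiE_iff split: if_splits)
qed

lemma gluing_data_mem: "F \<in> gluing_data P X0 \<Longrightarrow> X \<in> P \<Longrightarrow> x \<in> X0 \<Longrightarrow> F X x \<in> X"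
  using gluing_data_bij bij_betwE by blast

lemma gluing_data_base: "F \<in> gluing_data P X0 \<Longrightarrow> x \<in> X0 \<Longrightarrow> F X0 x = x"
  using X0 by (auto simp: gluing_data_def PiE_iff)

lemma inter_glue:
  assumes "F \<in> gluing_data P X0" and "x \<in> X0" and "X \<in> P"
  shows "X \<inter> glue P F x = {F X x}"
  using assms class_unique gluing_data_mem by (fastforce simp: glue_def)

lemma glue_eqD:
  assumes "F \<in> gluing_data P X0" and "G \<in> gluing_data P X0" and "x \<in> X0" and "y \<in> X0"
    and "glue P F x = glue P G y"
  shows "x = y"
  using inter_glue[OF assms(1,3) X0] inter_glue[OF assms(2,4) X0] assms
  by (simp add: gluing_data_base)

lemma partition_on_glue:
  assumes F: "F \<in> gluing_data P X0"
  shows "partition_on A (glue P F ` X0)"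
proof (rule partition_onI)
  show "\<Union> (glue P F ` X0) = A"
  proof
    show "\<Union> (glue P F ` X0) \<subseteq> A"
      using part gluing_data_mem[OF F] by (auto simp: glue_def partition_on_def)
    show "A \<subseteq> \<Union> (glue P F ` X0)"
    proof
      fix a assume "a \<in> A"
      then obtain X where X: "X \<in> P" "a \<in> X"
        using part by (auto simp: partition_on_def)
      then obtain x where "x \<in> X0" "a = F X x"
        using gluing_data_bij[OF F] by (auto simp: bij_betw_def)
      with X show "a \<in> \<Union> (glue P F ` X0)"
        by (auto simp: glue_def)
    qed
  qed
next
  fix Y Z assume YZ: "Y \<in> glue P F ` X0" "Z \<in> glue P F ` X0" "Y \<noteq> Z"
  then obtain x y where xy: "x \<in> X0" "y \<in> X0" "Y = glue P F x" "Z = glue P F y"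
    by auto
  show "disjnt Y Z"
  proof (rule ccontr)
    assume "\<not> disjnt Y Z"
    then obtain X X' where X: "X \<in> P" "X' \<in> P" "F X x = F X' y"
      using xy by (auto simp: disjnt_def glue_def)
    then have "X = X'"
      using class_unique gluing_data_mem[OF F] xy by metis
    then have "x = y"
      using gluing_data_bij[OF F X(1)] X xy by (auto simp: bij_betw_def dest: inj_onD)
    with xy YZ show False by simp
  qed
next
  show "{} \<notin> glue P F ` X0"
    using X0 by (auto simp: glue_def)
qed

lemma card_glue:
  assumes F: "F \<in> gluing_data P X0" and "x \<in> X0"
  shows "card (glue P F x) = card P"
  unfolding glue_def
proof (rule card_image, rule inj_onI)
  fix X Y assume "X \<in> P" "Y \<in> P" "F X x = F Y x"
  then show "X = Y"
    using class_unique gluing_data_mem[OF F] assms(2) by metis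
qed

lemma inj_on_glue: "inj_on (\<lambda>F. glue P F ` X0) (gluing_data P X0)"
proof (rule inj_onI)
  fix F G
  assume FG: "F \<in> gluing_data P X0" "G \<in> gluing_data P X0" and eq: "glue P F ` X0 = glue P G ` X0"
  \<comment> \<open>Each transversal is labelled by its point in \<open>X0\<close>, so both data produce it with the same label.\<close>
  have same: "glue P F x = glue P G x" if "x \<in> X0" for x
  proof -
    have "glue P F x \<in> glue P G ` X0"
      using eq that by blast
    then obtain y where "y \<in> X0" "glue P F x = glue P G y"
      by blast
    then show ?thesis
      using glue_eqD[OF FG that] by blast
  qed
  have "F X x = G X x" if "X \<in> P" "x \<in> X0" for X x
    using inter_glue[OF FG(1) that(2,1)] inter_glue[OF FG(2) that(2,1)] same[OF that(2)] by simp
  moreover have "F X \<in> extensional X0" "G X \<in> extensional X0" if "X \<in> P" for X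
    using FG[THEN gluing_data_extensional, OF that] .
  ultimately have "F X = G X" if "X \<in> P" for X
    using that by (blast intro: extensionalityI)
  then show "F = G"
    using PiE_ext[OF FG[unfolded gluing_data_def]] by simp
qed

text \<open>
  A partition into transversals is recovered from the data sending \<open>x \<in> X0\<close> to the point where the
  transversal through \<open>x\<close> meets \<open>X\<close>. Each such map is a bijection because both \<open>X0\<close> and \<open>X\<close> are
  in bijection with the set of transversals.
\<close>

lemma transversal_partition_is_glued:
  assumes partQ: "partition_on A Q" and single: "\<And>X Y. X \<in> P \<Longrightarrow> Y \<in> Q \<Longrightarrow> card (X \<inter> Y) = 1"
  shows "\<exists>F\<in>gluing_data P X0. glue P F ` X0 = Q"
proof -
  define meet where "meet X Y = the_elem (X \<inter> Y)" for X Y :: "'a set"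
  have meet: "X \<inter> Y = {meet X Y}" if "X \<in> P" "Y \<in> Q" for X Y
    unfolding meet_def using single[OF that]
    by (simp add: is_singleton_altdef flip: is_singleton_the_elem)
  have meetI: "a = meet X Y" if "X \<in> P" "Y \<in> Q" "a \<in> X" "a \<in> Y" for X Y a
    using meet[OF that(1,2)] that(3,4) by blast
  have meetD: "meet X Y \<in> X" "meet X Y \<in> Y" if "X \<in> P" "Y \<in> Q" for X Y
    using meet[OF that] by blast+
  have uniqueQ: "Y = Z" if "Y \<in> Q" "Z \<in> Q" "a \<in> Y" "a \<in> Z" for Y Z a
    using partQ that by (auto simp: partition_on_def disjoint_def)
  have bij_meet: "bij_betw (meet X) Q X" if X: "X \<in> P" for X
    unfolding bij_betw_def
  proof
    show "inj_on (meet X) Q"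
      using uniqueQ meetD[OF X] by (metis inj_onI)
    have "a \<in> meet X ` Q" if "a \<in> X" for a
    proof -
      have "a \<in> A"
        using that X part by (auto simp: partition_on_def)
      then obtain Y where "Y \<in> Q" "a \<in> Y"
        using partQ by (auto simp: partition_on_def)
      then show ?thesis
        using meetI[OF X _ that] by blast
    qed
    then show "meet X ` Q = X"
      using meetD[OF X] by blast
  qed
  define through where "through = inv_into Q (meet X0)"
  have bij_through: "bij_betw through X0 Q"
    unfolding through_def by (rule bij_betw_inv_into[OF bij_meet[OF X0]])
  have meet_through: "meet X0 (through x) = x" if "x \<in> X0" for x
    unfolding through_def using bij_meet[OF X0] that by (rule bij_betw_inv_into_right)
  define F where "F = (\<lambda>X\<in>P. \<lambda>x\<in>X0. meet X (through x))"
  have F: "F \<in> gluing_data P X0"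
    unfolding gluing_data_def
  proof
    fix X assume X: "X \<in> P"
    have "bij_betw (F X) X0 X"
      using bij_betw_trans[OF bij_through bij_meet[OF X]] X by (simp add: F_def o_def)
    moreover from this have "F X \<in> X0 \<rightarrow>\<^sub>E X"
      using X by (auto simp: F_def dest: bij_betwE)
    moreover have "F X0 = (\<lambda>x\<in>X0. x)"
      using X0 meet_through by (auto simp: F_def)
    ultimately show "F X \<in> (if X = X0 then {\<lambda>x\<in>X0. x} else bijections X0 X)"
      by (simp add: bijections_def)
  qed (simp add: F_def)
  have "glue P F x = through x" if x: "x \<in> X0" for x
  proof -
    have thr: "through x \<in> Q"
      using bij_through x by (auto dest: bij_betwE)
    have "through x = (\<lambda>X. meet X (through x)) ` P"
    proof
      show "through x \<subseteq> (\<lambda>X. meet X (through x)) ` P"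
      proof
        fix a assume a: "a \<in> through x"
        then have "a \<in> A"
          using thr partQ by (auto simp: partition_on_def)
        then obtain X where "X \<in> P" "a \<in> X"
          using part by (auto simp: partition_on_def)
        then show "a \<in> (\<lambda>X. meet X (through x)) ` P"
          using meetI[OF _ thr _ a] by blast
      qed
      show "(\<lambda>X. meet X (through x)) ` P \<subseteq> through x"
        using meetD(2)[OF _ thr] by blast
    qed
    then show ?thesis
      using x by (simp add: glue_def F_def)
  qed
  then have "glue P F ` X0 = through ` X0"
    by simp
  also have "\<dots> = Q"
    using bij_through by (simp add: bij_betw_def)
  finally show ?thesis
    using F by blast
qed

end

section \<open>Neighbours in the qualitative independence graph\<close>

lemma bij_betw_neighbours:
  assumes finA: "finite A" and cardA: "card A = k\<^sup>2" and P: "P \<in> QI_verts A k" and X0: "X0 \<in> P"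
  shows "bij_betw (\<lambda>F. glue P F ` X0) (gluing_data P X0)
    {Q \<in> QI_verts A k. qualitatively_independent P Q}"
  unfolding bij_betw_def
proof
  have part: "partition_on A P" and cardP: "card P = k"
    using P by (auto simp: QI_verts_def)
  show "inj_on (\<lambda>F. glue P F ` X0) (gluing_data P X0)"
    by (rule inj_on_glue[OF part X0])
  have "glue P F ` X0 \<in> QI_verts A k \<and> qualitatively_independent P (glue P F ` X0)"
    if F: "F \<in> gluing_data P X0" for F
  proof
    have "card (glue P F ` X0) = card X0"
      using glue_eqD[OF part X0 F F] by (intro card_image inj_onI)
    then show "glue P F ` X0 \<in> QI_verts A k"
      using partition_on_glue[OF part X0 F] card_glue[OF part X0 F] cardP
        card_class_eq[OF finA cardA P X0]
      by (auto simp: QI_verts_def)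
    show "qualitatively_independent P (glue P F ` X0)"
      using inter_glue[OF part X0 F] by (auto simp: qualitatively_independent_def)
  qed
  moreover have "Q \<in> (\<lambda>F. glue P F ` X0) ` gluing_data P X0"
    if Q: "Q \<in> QI_verts A k" and ind: "qualitatively_independent P Q" for Q
  proof -
    have partQ: "partition_on A Q" and cardQ: "card Q = k"
      using Q by (auto simp: QI_verts_def)
    have "card (X \<inter> Y) = 1" if "X \<in> P" "Y \<in> Q" for X Y
    proof (rule card_inter_class_eq_1[OF finA partQ])
      show "X \<subseteq> A"
        using part that by (auto simp: partition_on_def)
      show "card X = card Q"
        using card_class_eq[OF finA cardA P that(1)] cardQ by simp
      show "X \<inter> Z \<noteq> {}" if "Z \<in> Q" for Z
        using ind \<open>X \<in> P\<close> that by (auto simp: qualitatively_independent_def)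
    qed (rule that)
    then show ?thesis
      using transversal_partition_is_glued[OF part X0 partQ] by blast
  qed
  ultimately show "(\<lambda>F. glue P F ` X0) ` gluing_data P X0
      = {Q \<in> QI_verts A k. qualitatively_independent P Q}"
    by blast
qed

lemma out_degree_QI:
  assumes "P \<in> QI_verts A k"
  shows "out_degree (with_proj (QI A k)) P
    = card {Q \<in> QI_verts A k. qualitatively_independent P Q}"
proof -
  have "out_arcs (with_proj (QI A k)) P
      = Pair P ` {Q \<in> QI_verts A k. qualitatively_independent P Q}"
    using assms by (auto simp: out_arcs_def QI_def)
  then show ?thesis
    by (simp add: out_degree_def card_image inj_on_def)
qed

theorem lemma5p4p4:
  fixes A :: "'a set" and k :: nat
  assumes "k > 0" and "finite A" and "card A = k\<^sup>2"
  shows "regular_graph (fact k ^ (k - 1)) (with_proj (QI A k))"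
  unfolding regular_graph_def
proof
  fix P assume "P \<in> verts (with_proj (QI A k))"
  then have P: "P \<in> QI_verts A k"
    by (simp add: QI_def)
  then have part: "partition_on A P" and cardP: "card P = k"
    by (auto simp: QI_verts_def)
  obtain X0 where X0: "X0 \<in> P"
    using cardP assms(1) by fastforce
  have classes: "finite X \<and> card X = k" if "X \<in> P" for X
    using card_class_eq[OF assms(2,3) P that] assms(1) card_gt_0_iff by metis
  have "out_degree (with_proj (QI A k)) P
      = card {Q \<in> QI_verts A k. qualitatively_independent P Q}"
    by (rule out_degree_QI[OF P])
  also have "\<dots> = card (gluing_data P X0)"
    by (rule bij_betw_same_card[OF bij_betw_neighbours[OF assms(2,3) P X0], symmetric])
  also have "\<dots> = fact k ^ (k - 1)"
    using card_gluing_data[OF finite_elements[OF assms(2) part] X0 classes] cardP by simp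
  finally show "out_degree (with_proj (QI A k)) P = fact k ^ (k - 1)" .
qed

end
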